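(* Let $n\ge 2$ and let $K_n$ be the complete graph on $n$ vertices. The $\chi$-chromatic mean of $K_n$ is $$\mu_{\chi}(K_n)=\frac{n+1}{2}$$ and the $\chi$-chromatic variance of $K_n$ is $$\sigma^2_{\chi}(K_n)=\frac{n^2-1}{12}.$$
   Context: Graphs are simple, finite, connected and non-trivial (at least two vertices). A proper $k$-colouring $\mathcal{C}=\{c_1,\ldots,c_k\}$ of a graph $G$ assigns one of the colours $c_1,\ldots,c_k$ to each vertex so that adjacent vertices have different colours, every colour being used. Let $\theta(c_i)$ be the number of vertices with colour $c_i$, so $\sum_{i=1}^k\theta(c_i)=|V(G)|$. The colouring sum is $\omega_{\mathcal{C}}(G)=\sum_{i=1}^k i\,\theta(c_i)$. The colouring mean is $\mu_{\mathcal{C}}(G)=\frac{\sum_{i=1}^k i\,\theta(c_i)}{\sum_{i=1}^k\theta(c_i)}$ and the colouring variance is $\sigma^2_{\mathcal{C}}(G)=\frac{\sum_{i=1}^k i^2\,\theta(c_i)}{\sum_{i=1}^k\theta(c_i)}-\left(\frac{\sum_{i=1}^k i\,\theta(c_i)}{\sum_{i=1}^k\theta(c_i)}\right)^2$. The $\chi$-chromatic mean $\mu_{\chi}(G)$ and $\chi$-chromatic variance $\sigma^2_{\chi}(G)$ are the colouring mean and colouring variance with respect to a proper colouring $\mathcal{C}$ of $G$ with the minimum number $k=\chi(G)$ of colours for which the colouring sum $\omega_{\mathcal{C}}(G)$ is minimum among all proper colourings with $\chi(G)$ colours. *)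

theory Defs
  imports Complex_Main "Graph_Theory.Kuratowski"
begin

text \<open>
  A simple graph is a symmetric loop-free digraph without parallel arcs (locale
  \<^locale>\<open>graph\<close> of the library), and \<^const>\<open>complete_digraph\<close> \<open>n G\<close> says that \<open>G\<close> is a
  complete graph on \<open>n\<close> vertices.

  The colour \<open>c\<^sub>i\<close> is represented by its index \<open>i\<close>. All quantities below
  depend on a colouring only through its values on \<^term>\<open>verts G\<close>.
\<close>

definition proper_colouring :: "('a, 'b) pre_digraph \<Rightarrow> nat \<Rightarrow> ('a \<Rightarrow> nat) \<Rightarrow> bool" where
  "proper_colouring G k c \<longleftrightarrow>
     c ` verts G = {1..k} \<and> (\<forall>u v. (u, v) \<in> arcs_ends G \<longrightarrow> c u \<noteq> c v)"

definition chromatic_number :: "('a, 'b) pre_digraph \<Rightarrow> nat" where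
  "chromatic_number G = (LEAST k. \<exists>c. proper_colouring G k c)"

definition colour_weight :: "('a, 'b) pre_digraph \<Rightarrow> ('a \<Rightarrow> nat) \<Rightarrow> nat \<Rightarrow> nat" where
  "colour_weight G c i = card {v \<in> verts G. c v = i}"

definition colouring_sum :: "('a, 'b) pre_digraph \<Rightarrow> nat \<Rightarrow> ('a \<Rightarrow> nat) \<Rightarrow> nat" where
  "colouring_sum G k c = (\<Sum>i=1..k. i * colour_weight G c i)"

definition colouring_mean :: "('a, 'b) pre_digraph \<Rightarrow> nat \<Rightarrow> ('a \<Rightarrow> nat) \<Rightarrow> real" where
  "colouring_mean G k c =
     (\<Sum>i=1..k. real i * real (colour_weight G c i)) / (\<Sum>i=1..k. real (colour_weight G c i))"

definition colouring_variance :: "('a, 'b) pre_digraph \<Rightarrow> nat \<Rightarrow> ('a \<Rightarrow> nat) \<Rightarrow> real" where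
  "colouring_variance G k c =
     (\<Sum>i=1..k. (real i)\<^sup>2 * real (colour_weight G c i)) / (\<Sum>i=1..k. real (colour_weight G c i))
     - ((\<Sum>i=1..k. real i * real (colour_weight G c i)) / (\<Sum>i=1..k. real (colour_weight G c i)))\<^sup>2"

definition chi_minimal_colouring :: "('a, 'b) pre_digraph \<Rightarrow> ('a \<Rightarrow> nat) \<Rightarrow> bool" where
  "chi_minimal_colouring G c \<longleftrightarrow>
     proper_colouring G (chromatic_number G) c \<and>
     (\<forall>c'. proper_colouring G (chromatic_number G) c' \<longrightarrow>
        colouring_sum G (chromatic_number G) c \<le> colouring_sum G (chromatic_number G) c')"

text \<open>
  The \<open>\<chi>\<close>-chromatic mean and variance are taken with respect to some sum-minimal colouring with
  \<open>\<chi>(G)\<close> colours. Such a colouring is not unique, and the variance may depend on its choice for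
  general \<open>G\<close>. Both notions are therefore relations between a graph and a real number; \<open>\<mu>\<^sub>\<chi>(G) = x\<close>
  means that \<open>x\<close> is the one and only number related to \<open>G\<close>.
\<close>

definition is_chi_chromatic_mean :: "('a, 'b) pre_digraph \<Rightarrow> real \<Rightarrow> bool" where
  "is_chi_chromatic_mean G x \<longleftrightarrow>
     (\<exists>c. chi_minimal_colouring G c \<and> x = colouring_mean G (chromatic_number G) c)"

definition is_chi_chromatic_variance :: "('a, 'b) pre_digraph \<Rightarrow> real \<Rightarrow> bool" where
  "is_chi_chromatic_variance G x \<longleftrightarrow>
     (\<exists>c. chi_minimal_colouring G c \<and> x = colouring_variance G (chromatic_number G) c)"

end

theory Submission
  imports Defs
begin

text \<open>
  Any two vertices of \<open>K\<^sub>n\<close> are adjacent, so a proper colouring is injective. As every colour is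
  used, it is a bijection from the vertices onto the colours \<open>1, \<dots>, n\<close>
  (\<open>proper_colouring_complete_iff\<close>). Hence the chromatic number is \<open>n\<close>, and in every proper
  colouring each colour occurs exactly once. All these colourings therefore have the same
  colouring sum, so each of them is sum-minimal, and each of them has the mean and the variance of
  the uniform distribution on \<open>{1..n}\<close>. The two values follow from the closed forms of
  \<open>1 + \<dots> + n\<close> and \<open>1\<^sup>2 + \<dots> + n\<^sup>2\<close>.
\<close>

text \<open>
  Since the surjection onto the colours is also injective, counting vertices determines the number
  of colours, so there is no proper colouring of \<open>K\<^sub>n\<close> with \<open>k \<noteq> n\<close> colours.
\<close>

lemma proper_colouring_complete_iff:
  assumes "complete_digraph n G"
  shows "proper_colouring G k c \<longleftrightarrow> k = n \<and> bij_betw c (verts G) {1..n}"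
proof -
  have card: "card (verts G) = n"
    using assms by (simp add: complete_digraph_def)
  have "(\<forall>u v. (u, v) \<in> arcs_ends G \<longrightarrow> c u \<noteq> c v) \<longleftrightarrow> inj_on c (verts G)"
    using assms by (auto simp: complete_digraph_def inj_on_def)
  then have "proper_colouring G k c \<longleftrightarrow> bij_betw c (verts G) {1..k}"
    by (auto simp: proper_colouring_def bij_betw_def)
  moreover have "k = n" if "bij_betw c (verts G) {1..k}"
    using bij_betw_same_card[OF that] card by simp
  ultimately show ?thesis
    by auto
qed

lemma ex_proper_colouring_complete:
  assumes "complete_digraph n G"
  shows "\<exists>c. proper_colouring G n c"
proof -
  interpret graph G
    using assms by (simp add: complete_digraph_def)
  have "card (verts G) = card {1..n}"
    using assms by (simp add: complete_digraph_def)
  then show ?thesis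
    using finite_same_card_bij[OF finite_verts, of "{1..n}"]
    by (auto simp: proper_colouring_complete_iff[OF assms])
qed

lemma chromatic_number_complete:
  assumes "complete_digraph n G"
  shows "chromatic_number G = n"
  unfolding chromatic_number_def
  using ex_proper_colouring_complete[OF assms]
  by (intro Least_equality) (auto simp: proper_colouring_complete_iff[OF assms])

lemma colour_weight_bij_betw:
  assumes "bij_betw c (verts G) A" and "i \<in> A"
  shows "colour_weight G c i = 1"
proof -
  obtain v where v: "v \<in> verts G" "c v = i"
    using assms by (auto simp: bij_betw_def)
  have "{u \<in> verts G. c u = i} = {v}"
    using assms(1) v by (auto simp: bij_betw_def inj_on_def)
  then show ?thesis
    by (simp add: colour_weight_def)
qed

text \<open>
  All colour weights equal one, so every proper colouring attains the same sum \<open>1 + \<dots> + n\<close>, which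
  is then the minimum.
\<close>

lemma chi_minimal_colouring_complete_iff:
  assumes "complete_digraph n G"
  shows "chi_minimal_colouring G c \<longleftrightarrow> bij_betw c (verts G) {1..n}"
proof -
  have "colouring_sum G n c' = (\<Sum>i=1..n. i)" if "bij_betw c' (verts G) {1..n}" for c'
    using that by (simp add: colouring_sum_def colour_weight_bij_betw)
  then show ?thesis
    by (auto simp: chi_minimal_colouring_def chromatic_number_complete[OF assms]
        proper_colouring_complete_iff[OF assms])
qed

lemma ex_chi_minimal_colouring_complete:
  assumes "complete_digraph n G"
  shows "\<exists>c. chi_minimal_colouring G c"
  using ex_proper_colouring_complete[OF assms]
  by (auto simp: chi_minimal_colouring_complete_iff[OF assms]
      proper_colouring_complete_iff[OF assms])

lemma sum_real_upto: "(\<Sum>i=1..n. real i) = real n * (real n + 1) / 2"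
  by (induction n) (simp_all add: field_simps)

lemma sum_real_squares_upto:
  "(\<Sum>i=1..n. (real i)\<^sup>2) = real n * (real n + 1) * (2 * real n + 1) / 6"
  by (induction n) (simp_all add: field_simps power2_eq_square)

lemma colouring_mean_bij_betw:
  assumes "bij_betw c (verts G) {1..n}" and "n > 0"
  shows "colouring_mean G n c = (real n + 1) / 2"
  using assms sum_real_upto[of n]
  by (simp add: colouring_mean_def colour_weight_bij_betw)

lemma colouring_variance_bij_betw:
  assumes "bij_betw c (verts G) {1..n}" and "n > 0"
  shows "colouring_variance G n c = ((real n)\<^sup>2 - 1) / 12"
proof -
  have "colouring_variance G n c =
      (\<Sum>i=1..n. (real i)\<^sup>2) / real n - ((\<Sum>i=1..n. real i) / real n)\<^sup>2"
    using assms by (simp add: colouring_variance_def colour_weight_bij_betw)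
  also have "\<dots> = (real n + 1) * (2 * real n + 1) / 6 - ((real n + 1) / 2)\<^sup>2"
    using assms(2) by (simp only: sum_real_upto sum_real_squares_upto) simp
  also have "\<dots> = ((real n)\<^sup>2 - 1) / 12"
    by (simp add: field_simps power2_eq_square)
  finally show ?thesis .
qed

theorem proposition2p6:
  fixes G :: "('a, 'b) pre_digraph" and n :: nat
  assumes "n \<ge> 2"
    and "complete_digraph n G"
  shows "(\<forall>x. is_chi_chromatic_mean G x \<longleftrightarrow> x = (real n + 1) / 2) \<and>
         (\<forall>x. is_chi_chromatic_variance G x \<longleftrightarrow> x = ((real n)\<^sup>2 - 1) / 12)"
proof -
  have "n > 0"
    using assms(1) by simp
  have mean: "colouring_mean G n c = (real n + 1) / 2"
    and variance: "colouring_variance G n c = ((real n)\<^sup>2 - 1) / 12"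
    if "chi_minimal_colouring G c" for c
    using that colouring_mean_bij_betw[OF _ \<open>n > 0\<close>] colouring_variance_bij_betw[OF _ \<open>n > 0\<close>]
    by (simp_all add: chi_minimal_colouring_complete_iff[OF assms(2)])
  show ?thesis
    unfolding is_chi_chromatic_mean_def is_chi_chromatic_variance_def
      chromatic_number_complete[OF assms(2)]
    using ex_chi_minimal_colouring_complete[OF assms(2)] mean variance by metis
qed

end
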